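(* Let $\mathbf T$ and $\widetilde{\mathbf T}$ be troupes. If $|\mathbf T_n\cap\mathsf{Branch}|=|\widetilde{\mathbf T}_n\cap\mathsf{Branch}|$ for all $n\geq 0$, then $|\mathbf T_n|=|\widetilde{\mathbf T}_n|$ for all $n\geq 0$.
   Context: Fix a finite set $\mathbf C$ of colors containing black and white. A binary plane tree is a finite (possibly empty) rooted tree in which every vertex has at most two children, every child is designated as either a left child or a right child (not both), and no vertex has two left children or two right children. A colored binary plane tree is a binary plane tree together with a function from its vertex set to $\mathbf C$. Trees are considered up to isomorphism; $\mathsf{CBPT}$ is the set of colored binary plane trees. $\mathbf T_n$ is the set of trees in $\mathbf T$ with $n$ vertices. $\mathsf{Branch}$ is the set of colored binary plane trees in which no vertex has $2$ children. Insertion: for nonempty $T_1,T_2\in\mathsf{CBPT}$ and a vertex $v$ of $T_1$, replace $v$ by two vertices joined by a left edge: the lower one is still called $v$ (it keeps the color and the left/right subtrees of $v$), and the upper one $v^*$ is black, takes the place of $v$ with respect to the parent of $v$ (if any), and has $v$ as left child; then attach $T_2$ as the right subtree of $v^*$. The result is $\nabla_v(T_1,T_2)$. Decomposition: if $v^*$ is a black vertex with $2$ children in $T$, let $v$ be its left child and $T_2$ its right subtree; delete $T_2$ and contract the edge $vv^*$ to a single vertex identified with $v$ (with the color of $v$), giving $T_1$; then $\Delta_{v^*}(T)=(T_1,T_2)$. A troupe is a set $\mathbf T\subseteq\mathsf{CBPT}$ such that: (i) $\nabla_v(T_1,T_2)\in\mathbf T$ for all nonempty $T_1,T_2\in\mathbf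 T$ and all vertices $v$ of $T_1$; (ii) $\Delta_{v^*}(T)\in\mathbf T\times\mathbf T$ for every $T\in\mathbf T$ and every black vertex $v^*$ of $T$ with $2$ children; (iii) for every $T\in\mathbf T$, all vertices of $T$ with $2$ children are black. *)

theory Defs
  imports "HOL-Library.Tree"
begin

text \<open>
  Colored binary plane trees up to isomorphism are the elements of the library type
  \<open>'c tree\<close>: \<open>Leaf\<close> is the empty tree, a vertex is a \<open>Node\<close> constructor together with its
  color, and an absent left or right child is an empty subtree. In particular \<open>size\<close> is the
  number of vertices. A vertex is addressed by the path leading to it from the root.
\<close>

datatype dir = Lft | Rgt

fun vertices :: "'c tree \<Rightarrow> dir list set" where
  "vertices Leaf = {}"
| "vertices (Node l c r) = insert [] ((#) Lft ` vertices l \<union> (#) Rgt ` vertices r)"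

fun subtree_at :: "'c tree \<Rightarrow> dir list \<Rightarrow> 'c tree" where
  "subtree_at T [] = T"
| "subtree_at T (Lft # p) = subtree_at (left T) p"
| "subtree_at T (Rgt # p) = subtree_at (right T) p"

fun replace_at :: "'c tree \<Rightarrow> dir list \<Rightarrow> 'c tree \<Rightarrow> 'c tree" where
  "replace_at T [] S = S"
| "replace_at (Node l c r) (Lft # p) S = Node (replace_at l p S) c r"
| "replace_at (Node l c r) (Rgt # p) S = Node l c (replace_at r p S)"
| "replace_at Leaf (d # p) S = Leaf"

definition color_at :: "'c tree \<Rightarrow> dir list \<Rightarrow> 'c" where
  "color_at T v = value (subtree_at T v)"

definition num_children :: "'c tree \<Rightarrow> dir list \<Rightarrow> nat" where
  "num_children T v =
     of_bool (left (subtree_at T v) \<noteq> Leaf) + of_bool (right (subtree_at T v) \<noteq> Leaf)"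

definition CBPT :: "'c set \<Rightarrow> 'c tree set" where
  "CBPT C = {T. set_tree T \<subseteq> C}"

definition Branch :: "'c set \<Rightarrow> 'c tree set" where
  "Branch C = {T \<in> CBPT C. \<forall>v \<in> vertices T. num_children T v \<noteq> 2}"

definition of_size :: "'c tree set \<Rightarrow> nat \<Rightarrow> 'c tree set" where
  "of_size TT n = {T \<in> TT. size T = n}"

text \<open>
  Insertion: the subtree rooted at \<open>v\<close> becomes the left subtree of the new black vertex
  \<open>v\<^sup>*\<close>, which takes the position of \<open>v\<close> and has right subtree \<open>T\<^sub>2\<close>. The first
  argument is the color black.
\<close>

definition insertion :: "'c \<Rightarrow> dir list \<Rightarrow> 'c tree \<Rightarrow> 'c tree \<Rightarrow> 'c tree" where
  "insertion black v T1 T2 = replace_at T1 v (Node (subtree_at T1 v) black T2)"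

text \<open>
  Decomposition: after deleting the right subtree of \<open>v\<^sup>*\<close>, contracting the edge to its left
  child \<open>v\<close> (with the color of \<open>v\<close> kept) puts the left subtree of \<open>v\<^sup>*\<close> in the position
  of \<open>v\<^sup>*\<close>.
\<close>

definition decomposition :: "dir list \<Rightarrow> 'c tree \<Rightarrow> 'c tree \<times> 'c tree" where
  "decomposition v T =
     (replace_at T v (left (subtree_at T v)), right (subtree_at T v))"

definition troupe :: "'c set \<Rightarrow> 'c \<Rightarrow> 'c tree set \<Rightarrow> bool" where
  "troupe C black TT \<longleftrightarrow>
     TT \<subseteq> CBPT C \<and>
     (\<forall>T1 \<in> TT. \<forall>T2 \<in> TT. T1 \<noteq> Leaf \<longrightarrow> T2 \<noteq> Leaf \<longrightarrow>
        (\<forall>v \<in> vertices T1. insertion black v T1 T2 \<in> TT)) \<and>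
     (\<forall>T \<in> TT. \<forall>v \<in> vertices T. color_at T v = black \<longrightarrow> num_children T v = 2 \<longrightarrow>
        decomposition v T \<in> TT \<times> TT) \<and>
     (\<forall>T \<in> TT. \<forall>v \<in> vertices T. num_children T v = 2 \<longrightarrow> color_at T v = black)"

text \<open>
  Over a finite color set there are finitely many trees of each size, so \<open>card\<close> really
  counts them.
\<close>

lemma finite_CBPT_size_le:
  assumes "finite C"
  shows "finite {T \<in> CBPT C. size T \<le> n}"
proof (induction n)
  case 0
  have "{T \<in> CBPT C. size T \<le> 0} \<subseteq> {Leaf}"
    by auto
  then show ?case
    using finite_subset by blast
next
  case (Suc n)
  let ?A = "{T \<in> CBPT C. size T \<le> n}"
  have "{T \<in> CBPT C. size T \<le> Suc n} \<subseteq>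
      insert Leaf ((\<lambda>(l, c, r). Node l c r) ` (?A \<times> C \<times> ?A))"
  proof
    fix T assume T: "T \<in> {T \<in> CBPT C. size T \<le> Suc n}"
    show "T \<in> insert Leaf ((\<lambda>(l, c, r). Node l c r) ` (?A \<times> C \<times> ?A))"
    proof (cases T)
      case (Node l c r)
      with T have "(l, c, r) \<in> ?A \<times> C \<times> ?A"
        by (auto simp: CBPT_def)
      with Node show ?thesis
        by (auto simp: image_iff)
    qed simp
  qed
  then show ?case
    using Suc assms by (meson finite_SigmaI finite_imageI finite_insert finite_subset)
qed

lemma finite_of_size:
  assumes "finite C" and "TT \<subseteq> CBPT C"
  shows "finite (of_size TT n)"
  by (rule finite_subset[OF _ finite_CBPT_size_le[OF assms(1), of n]])
    (use assms(2) in \<open>auto simp: of_size_def\<close>)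

lemma finite_vertices: "finite (vertices T)"
  by (induction T) auto

lemma card_vertices: "card (vertices T) = size T"
proof (induction T)
  case (Node l c r)
  have "card ((#) Lft ` vertices l \<union> (#) Rgt ` vertices r) = size l + size r"
    using Node by (subst card_Un_disjoint) (auto simp: finite_vertices card_image)
  moreover have "[] \<notin> (#) Lft ` vertices l \<union> (#) Rgt ` vertices r"
    by auto
  ultimately show ?case
    by (simp add: finite_vertices)
qed simp

lemma decomposition_insertion:
  "v \<in> vertices T1 \<Longrightarrow> decomposition v (insertion black v T1 T2) = (T1, T2)"
  unfolding decomposition_def insertion_def
  by (induction T1 arbitrary: v) auto

end

theory Submission
  imports Defs
begin

text \<open>
  A troupe is freely generated by its branches, so its size distribution depends only on that of
  its branches. Walk down a nonempty tree \<open>T\<close> from the root, at each vertex with two children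
  contracting that vertex into its left child and setting its right subtree aside. What remains is
  a branch, the \<open>trunk\<close> of \<open>T\<close>. Several consecutive vertices may be contracted into the same
  vertex of the trunk, so what is set aside (\<open>grafts\<close>) is one list of nonempty trees for every
  vertex of the trunk. If all vertices with two children are black, then nothing is lost: \<open>graft\<close>
  recovers \<open>T\<close> from its trunk and its grafts, and every branch decorated with lists of
  nonempty trees arises in this way.

  Each contraction is a decomposition and each reattachment an insertion, so a tree with black
  forks belongs to a troupe exactly when its trunk and all its grafts do. The grafts are smaller
  than \<open>T\<close>, and the size of \<open>T\<close> is that of the trunk plus one more than the size of each graft.
  Hence a size-preserving bijection between the branches of two troupes extends to the
  troupes by recursion: replace the trunk by its image and transplant the grafts, themselves
  transformed, to the corresponding positions (\<open>transplant\<close>). This map is injective and preserves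
  size, so \<open>card (of_size TT n) \<le> card (of_size TT' n)\<close>; the other inequality holds by symmetry.
\<close>

section \<open>Subtrees, replacement and forks\<close>

lemma subtree_at_Leaf: "subtree_at Leaf p = Leaf"
proof (induction p)
  case (Cons d p)
  then show ?case by (cases d) auto
qed simp

lemma replace_at_subtree_at: "replace_at T p (subtree_at T p) = T"
proof (induction T arbitrary: p)
  case Leaf
  show ?case by (cases p) (auto simp: subtree_at_Leaf)
next
  case (Node l c r)
  show ?case by (cases "(Node l c r, p)" rule: subtree_at.cases) (auto simp: Node.IH)
qed

lemma subtree_at_replace_at:
  "p \<in> vertices T \<Longrightarrow> subtree_at (replace_at T p S) p = S"
  by (induction T arbitrary: p) auto

lemma replace_at_replace_at:
  "p \<in> vertices T \<Longrightarrow> replace_at (replace_at T p S) p S' = replace_at T p S'"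
  by (induction T arbitrary: p) auto

lemma subtree_at_append: "subtree_at T (p @ q) = subtree_at (subtree_at T p) q"
  by (induction T p rule: subtree_at.induct) auto

lemma replace_at_append:
  "p \<in> vertices T \<Longrightarrow> replace_at T (p @ q) S = replace_at T p (replace_at (subtree_at T p) q S)"
  by (induction T arbitrary: p) auto

lemma vertices_if_subtree_at: "subtree_at T p \<noteq> Leaf \<Longrightarrow> p \<in> vertices T"
proof (induction T p rule: subtree_at.induct)
  case (1 T)
  then show ?case by (cases T) auto
next
  case (2 T p)
  then show ?case by (cases T) (auto simp: subtree_at_Leaf)
next
  case (3 T p)
  then show ?case by (cases T) (auto simp: subtree_at_Leaf)
qed

lemma vertices_replace_at:
  "p \<in> vertices T \<Longrightarrow> S \<noteq> Leaf \<Longrightarrow> p \<in> vertices (replace_at T p S)"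
  by (simp add: vertices_if_subtree_at subtree_at_replace_at)

definition forkless :: "'c tree \<Rightarrow> bool" where
  "forkless T \<longleftrightarrow> (\<forall>v \<in> vertices T. num_children T v \<noteq> 2)"

definition black_forks :: "'c \<Rightarrow> 'c tree \<Rightarrow> bool" where
  "black_forks black T \<longleftrightarrow>
     (\<forall>v \<in> vertices T. num_children T v = 2 \<longrightarrow> color_at T v = black)"

lemma num_children_eq_2:
  "num_children T v = 2 \<longleftrightarrow> left (subtree_at T v) \<noteq> Leaf \<and> right (subtree_at T v) \<noteq> Leaf"
  by (simp add: num_children_def)

lemma forkless_simps [simp]:
  "forkless Leaf"
  "forkless (Node l c r) \<longleftrightarrow> (l = Leaf \<or> r = Leaf) \<and> forkless l \<and> forkless r"
  by (auto simp: forkless_def num_children_eq_2)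

lemma black_forks_simps [simp]:
  "black_forks black Leaf"
  "black_forks black (Node l c r) \<longleftrightarrow>
     (l \<noteq> Leaf \<longrightarrow> r \<noteq> Leaf \<longrightarrow> c = black) \<and> black_forks black l \<and> black_forks black r"
  by (auto simp: black_forks_def num_children_eq_2 color_at_def ball_Un)

section \<open>The trunk of a tree and its grafts\<close>

fun trunk :: "'c tree \<Rightarrow> 'c tree" where
  "trunk Leaf = Leaf"
| "trunk (Node l c r) =
     (if l \<noteq> Leaf \<and> r \<noteq> Leaf then trunk l else Node (trunk l) c (trunk r))"

text \<open>
  The lists are in the order of the vertices of the trunk, and each list is in top-down order. At
  a vertex without a fork at most one of the two subtrees contributes, so appending their lists
  merely avoids a case distinction. At a fork, \<open>grafts l\<close> is nonempty, because \<open>l\<close> is.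
\<close>

fun grafts :: "'c tree \<Rightarrow> 'c tree list list" where
  "grafts Leaf = []"
| "grafts (Node l c r) =
     (if l \<noteq> Leaf \<and> r \<noteq> Leaf then (r # hd (grafts l)) # tl (grafts l)
      else [] # (grafts l @ grafts r))"

text \<open>
  The intended first argument \<open>b\<close> is a branch, with as many lists as vertices. Passing
  the same remaining lists to both subtrees is then harmless, because one of them is empty.
\<close>

fun graft :: "'c \<Rightarrow> 'c tree \<Rightarrow> 'c tree list list \<Rightarrow> 'c tree" where
  "graft black Leaf ds = Leaf"
| "graft black (Node l c r) ds =
     foldr (\<lambda>t s. Node s black t) (hd ds) (Node (graft black l (tl ds)) c (graft black r (tl ds)))"

lemma trunk_eq_Leaf [simp]: "trunk T = Leaf \<longleftrightarrow> T = Leaf"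
  by (induction T) auto

lemma grafts_eq_Nil [simp]: "grafts T = [] \<longleftrightarrow> T = Leaf"
  by (cases T) auto

lemma forkless_trunk: "forkless (trunk T)"
  by (induction T) auto

lemma length_grafts: "length (grafts T) = size (trunk T)"
  by (induction T) (simp_all, metis One_nat_def Suc_pred eq_size_0 neq0_conv trunk_eq_Leaf)

text \<open>This makes recursion along grafts well-founded.\<close>

lemma size_grafts_less:
  "d \<in> set (grafts T) \<Longrightarrow> t \<in> set d \<Longrightarrow> size t < size T"
proof (induction T arbitrary: d t)
  case (Node l c r)
  show ?case
  proof (cases "l \<noteq> Leaf \<and> r \<noteq> Leaf")
    case True
    then obtain e es where "grafts l = e # es" by (metis grafts_eq_Nil neq_Nil_conv)
    then have "t = r \<or> (\<exists>d' \<in> set (grafts l). t \<in> set d')"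
      using Node.prems True by auto
    then show ?thesis using Node.IH(1) by fastforce
  next
    case False
    then show ?thesis using Node.prems Node.IH by fastforce
  qed
qed simp

lemma grafts_nonempty: "d \<in> set (grafts T) \<Longrightarrow> Leaf \<notin> set d"
proof (induction T arbitrary: d)
  case (Node l c r)
  show ?case
  proof (cases "l \<noteq> Leaf \<and> r \<noteq> Leaf")
    case True
    then obtain e es where "grafts l = e # es" by (metis grafts_eq_Nil neq_Nil_conv)
    then show ?thesis using Node.prems Node.IH(1) True by auto
  next
    case False
    then show ?thesis using Node.prems Node.IH by auto
  qed
qed simp

text \<open>
  Contracting a fork forgets only its color, which is why the forks have to be black here.
\<close>

lemma graft_trunk_grafts:
  "black_forks black T \<Longrightarrow> graft black (trunk T) (grafts T) = T"
proof (induction T)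
  case (Node l c r)
  show ?case
  proof (cases "l \<noteq> Leaf \<and> r \<noteq> Leaf")
    case True
    then obtain l' c' r' where l': "trunk l = Node l' c' r'"
      by (metis neq_Leaf_iff trunk_eq_Leaf)
    from True Node.prems have "c = black" "graft black (trunk l) (grafts l) = l"
      using Node.IH(1) by auto
    then show ?thesis using True l' by simp
  next
    case False
    then show ?thesis using Node by auto
  qed
qed simp

lemma foldr_Node_eq_Leaf [simp]:
  "foldr (\<lambda>t s. Node s black t) d s = Leaf \<longleftrightarrow> d = [] \<and> s = Leaf"
  by (cases d) auto

lemma trunk_foldr_Node:
  "Leaf \<notin> set d \<Longrightarrow> s \<noteq> Leaf \<Longrightarrow> trunk (foldr (\<lambda>t s. Node s black t) d s) = trunk s"
  by (induction d) auto

lemma grafts_foldr_Node: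
  "Leaf \<notin> set d \<Longrightarrow> s \<noteq> Leaf \<Longrightarrow>
   grafts (foldr (\<lambda>t s. Node s black t) d s) = (d @ hd (grafts s)) # tl (grafts s)"
  by (induction d) auto

lemma size_foldr_Node:
  "size (foldr (\<lambda>t s. Node s black t) d s) = size s + (\<Sum>t\<leftarrow>d. Suc (size t))"
  by (induction d) auto

lemma graft_eq_Leaf [simp]: "graft black b ds = Leaf \<longleftrightarrow> b = Leaf"
  by (cases b) auto

text \<open>
  Here and in \<open>grafts_graft\<close> the grafts have to be nonempty: a vertex whose right subtree is an
  empty graft is not a fork, so it would stay in the trunk.
\<close>

lemma trunk_graft:
  "\<lbrakk>forkless b; \<forall>d \<in> set ds. Leaf \<notin> set d; length ds = size b\<rbrakk> \<Longrightarrow> trunk (graft black b ds) = b"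
proof (induction b arbitrary: ds)
  case (Node l c r)
  then obtain d ds' where "ds = d # ds'" by (cases ds) auto
  then show ?case using Node by (auto simp: trunk_foldr_Node)
qed simp

lemma grafts_graft:
  "\<lbrakk>forkless b; \<forall>d \<in> set ds. Leaf \<notin> set d; length ds = size b\<rbrakk> \<Longrightarrow> grafts (graft black b ds) = ds"
proof (induction b arbitrary: ds)
  case (Node l c r)
  then obtain d ds' where "ds = d # ds'" by (cases ds) auto
  then show ?case using Node by (auto simp: grafts_foldr_Node)
qed simp

lemma size_graft:
  "\<lbrakk>forkless b; length ds = size b\<rbrakk> \<Longrightarrow>
   size (graft black b ds) = size b + (\<Sum>d\<leftarrow>ds. \<Sum>t\<leftarrow>d. Suc (size t))"
proof (induction b arbitrary: ds)
  case (Node l c r)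
  then obtain d ds' where "ds = d # ds'" by (cases ds) auto
  then show ?case using Node by (auto simp: size_foldr_Node)
qed simp

section \<open>Troupes are closed under taking and building trunks and grafts\<close>

lemma troupe_black_forks: "troupe C black TT \<Longrightarrow> T \<in> TT \<Longrightarrow> black_forks black T"
  by (simp add: troupe_def black_forks_def)

text \<open>
  A subtree of a member of a troupe need not be a member, so the induction is on a subtree \<open>U\<close> at
  position \<open>p\<close> of a member \<open>T\<close>, and only this part of \<open>T\<close> is contracted to its trunk.
\<close>

lemma troupe_trunk_grafts_at:
  assumes troupe: "troupe C black TT"
  shows "T \<in> TT \<Longrightarrow> subtree_at T p = U \<Longrightarrow>
    replace_at T p (trunk U) \<in> TT \<and> (\<forall>d \<in> set (grafts U). set d \<subseteq> TT)"
proof (induction U arbitrary: T p)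
  case Leaf
  then show ?case using replace_at_subtree_at[of T p] by simp
next
  case (Node l c r)
  have p: "p \<in> vertices T" using Node.prems by (simp add: vertices_if_subtree_at)
  show ?case
  proof (cases "l \<noteq> Leaf \<and> r \<noteq> Leaf")
    case True
    then have two: "num_children T p = 2" using Node.prems by (simp add: num_children_eq_2)
    then have "decomposition p T \<in> TT \<times> TT"
      using troupe Node.prems p unfolding troupe_def by blast
    then have T1: "replace_at T p l \<in> TT" and r: "r \<in> TT"
      using Node.prems by (auto simp: decomposition_def)
    have "replace_at T p (trunk l) \<in> TT" "\<forall>d \<in> set (grafts l). set d \<subseteq> TT"
      using Node.IH(1)[OF T1, of p] p by (auto simp: subtree_at_replace_at replace_at_replace_at)
    moreover obtain e es where "grafts l = e # es"
      using True by (metis grafts_eq_Nil neq_Nil_conv)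
    ultimately show ?thesis using True r by auto
  next
    case False
    have "replace_at T p (Node (trunk l) c r) \<in> TT" "\<forall>d \<in> set (grafts l). set d \<subseteq> TT"
      using Node.IH(1)[OF Node.prems(1), of "p @ [Lft]"] Node.prems(2) p
      by (auto simp: subtree_at_append replace_at_append)
    moreover have "replace_at T p (Node l c (trunk r)) \<in> TT" "\<forall>d \<in> set (grafts r). set d \<subseteq> TT"
      using Node.IH(2)[OF Node.prems(1), of "p @ [Rgt]"] Node.prems(2) p
      by (auto simp: subtree_at_append replace_at_append)
    ultimately show ?thesis using False by auto
  qed
qed

corollary troupe_trunk: "troupe C black TT \<Longrightarrow> T \<in> TT \<Longrightarrow> trunk T \<in> TT"
  using troupe_trunk_grafts_at[of C black TT T "[]"] by simp

corollary troupe_grafts: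
  "troupe C black TT \<Longrightarrow> T \<in> TT \<Longrightarrow> d \<in> set (grafts T) \<Longrightarrow> t \<in> set d \<Longrightarrow> t \<in> TT"
  using troupe_trunk_grafts_at[of C black TT T "[]"] by auto

lemma troupe_insert_list_at:
  assumes troupe: "troupe C black TT" and T: "T \<in> TT" and p: "p \<in> vertices T"
    and d: "set d \<subseteq> TT - {Leaf}"
  shows "replace_at T p (foldr (\<lambda>t s. Node s black t) d (subtree_at T p)) \<in> TT"
  using d
proof (induction d)
  case Nil
  then show ?case using T by (simp add: replace_at_subtree_at)
next
  case (Cons t d)
  define S where "S = foldr (\<lambda>t s. Node s black t) d (subtree_at T p)"
  have S: "S \<noteq> Leaf"
  proof (cases d)
    case Nil
    have "subtree_at T p \<noteq> Leaf" using p by (induction T arbitrary: p) auto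
    then show ?thesis using Nil by (simp add: S_def)
  qed (simp add: S_def)
  let ?T = "replace_at T p S"
  have "?T \<in> TT" using Cons by (simp add: S_def)
  moreover have v: "p \<in> vertices ?T" using p S by (rule vertices_replace_at)
  moreover have "?T \<noteq> Leaf" using v by auto
  ultimately have "insertion black p ?T t \<in> TT"
    using troupe Cons.prems unfolding troupe_def by auto
  then show ?case
    using p by (simp add: insertion_def subtree_at_replace_at replace_at_replace_at S_def)
qed

text \<open>
  Insertions, too, take place in a member of the troupe, hence again the surrounding tree \<open>T\<close>. At
  each vertex of the branch the lists below it are grafted first, since that leaves the vertex at
  its position, whereas grafting its own list pushes it down.
\<close>

lemma troupe_graft_at:
  assumes troupe: "troupe C black TT"
  shows "\<lbrakk>T \<in> TT; subtree_at T p = b; forkless b; length ds = size b;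
      \<forall>d \<in> set ds. set d \<subseteq> TT - {Leaf}\<rbrakk> \<Longrightarrow> replace_at T p (graft black b ds) \<in> TT"
proof (induction b arbitrary: T p ds)
  case Leaf
  then show ?case using replace_at_subtree_at[of T p] by simp
next
  case (Node l c r)
  have p: "p \<in> vertices T" using Node.prems by (simp add: vertices_if_subtree_at)
  obtain d ds' where ds: "ds = d # ds'" using Node.prems(4) by (cases ds) auto
  let ?S = "Node (graft black l ds') c (graft black r ds')"
  have S: "replace_at T p ?S \<in> TT"
  proof (cases "l = Leaf")
    case True
    then show ?thesis
      using Node.IH(2)[of T "p @ [Rgt]" ds'] Node.prems p ds
      by (auto simp: subtree_at_append replace_at_append)
  next
    case False
    then show ?thesis
      using Node.IH(1)[of T "p @ [Lft]" ds'] Node.prems p ds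
      by (auto simp: subtree_at_append replace_at_append)
  qed
  have "p \<in> vertices (replace_at T p ?S)" using p by (simp add: vertices_replace_at)
  from troupe_insert_list_at[OF troupe S this, of d] show ?case
    using Node.prems ds p by (simp add: subtree_at_replace_at replace_at_replace_at)
qed

corollary troupe_graft:
  assumes "troupe C black TT" "b \<in> TT" "forkless b" "length ds = size b"
    and "\<forall>d \<in> set ds. set d \<subseteq> TT - {Leaf}"
  shows "graft black b ds \<in> TT"
  using troupe_graft_at[OF assms(1,2), of "[]"] assms by simp

section \<open>Extending a map on branches to whole trees\<close>

function transplant :: "'c \<Rightarrow> ('c tree \<Rightarrow> 'c tree) \<Rightarrow> 'c tree \<Rightarrow> 'c tree" where
  "transplant black \<beta> T =
     graft black (\<beta> (trunk T)) (map (map (transplant black \<beta>)) (grafts T))"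
  by pat_completeness auto
termination
  by (relation "Wellfounded.measure (\<lambda>(black, \<beta>, T). size T)") (auto intro: size_grafts_less)

declare transplant.simps [simp del]

lemma size_transplant:
  assumes troupe: "troupe C black TT"
    and \<beta>: "\<And>b. b \<in> TT \<Longrightarrow> forkless b \<Longrightarrow> forkless (\<beta> b) \<and> size (\<beta> b) = size b"
  shows "T \<in> TT \<Longrightarrow> size (transplant black \<beta> T) = size T"
proof (induction T rule: measure_induct_rule[of size])
  case (less T)
  let ?\<phi> = "transplant black \<beta>"
  have b: "forkless (\<beta> (trunk T))" "size (\<beta> (trunk T)) = size (trunk T)"
    using \<beta> troupe_trunk[OF troupe less.prems] forkless_trunk by blast+
  have IH: "size (?\<phi> t) = size t" if "d \<in> set (grafts T)" "t \<in> set d" for d t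
    using less.IH[OF size_grafts_less] troupe_grafts[OF troupe less.prems] that by blast
  have "size (?\<phi> T) = size (trunk T) + (\<Sum>d\<leftarrow>grafts T. \<Sum>t\<leftarrow>d. Suc (size (?\<phi> t)))"
    using b by (simp add: transplant.simps[of black \<beta> T] size_graft length_grafts comp_def)
  also have "(\<Sum>d\<leftarrow>grafts T. \<Sum>t\<leftarrow>d. Suc (size (?\<phi> t))) = (\<Sum>d\<leftarrow>grafts T. \<Sum>t\<leftarrow>d. Suc (size t))"
    by (intro arg_cong[where f = sum_list] map_cong refl) (simp add: IH)
  also have "size (trunk T) + \<dots> = size (graft black (trunk T) (grafts T))"
    by (simp add: size_graft forkless_trunk length_grafts)
  also have "\<dots> = size T"
    using graft_trunk_grafts[OF troupe_black_forks[OF troupe less.prems]] by simp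
  finally show ?case .
qed

text \<open>
  Grafting is inverse to taking trunk and grafts, so trunk and grafts of the image determine
  the trunk of the original tree through \<open>\<beta>\<close> and its grafts by induction.
\<close>

lemma inj_on_transplant:
  assumes troupe: "troupe C black TT"
    and \<beta>: "\<And>b. b \<in> TT \<Longrightarrow> forkless b \<Longrightarrow> forkless (\<beta> b) \<and> size (\<beta> b) = size b"
    and inj: "inj_on \<beta> {b \<in> TT. forkless b}"
  shows "inj_on (transplant black \<beta>) TT"
proof (rule inj_onI)
  let ?\<phi> = "transplant black \<beta>"
  have decompose: "trunk (?\<phi> T) = \<beta> (trunk T) \<and> grafts (?\<phi> T) = map (map ?\<phi>) (grafts T)"
    if T: "T \<in> TT" for T
  proof -
    have b: "forkless (\<beta> (trunk T))" "size (\<beta> (trunk T)) = size (trunk T)"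
      using \<beta> troupe_trunk[OF troupe T] forkless_trunk by blast+
    \<comment> \<open>Transformed grafts are nonempty because their sizes have not changed.\<close>
    have "?\<phi> t \<noteq> Leaf" if "d \<in> set (grafts T)" "t \<in> set d" for d t
      using size_transplant[OF troupe \<beta> troupe_grafts[OF troupe T that]] grafts_nonempty that
      by (metis eq_size_0)
    then have "\<forall>d \<in> set (map (map ?\<phi>) (grafts T)). Leaf \<notin> set d"
      by (fastforce simp: image_iff)
    then show ?thesis
      using b by (simp add: transplant.simps[of black \<beta> T] trunk_graft grafts_graft length_grafts)
  qed
  fix S T
  show "S \<in> TT \<Longrightarrow> T \<in> TT \<Longrightarrow> ?\<phi> S = ?\<phi> T \<Longrightarrow> S = T"
  proof (induction S arbitrary: T rule: measure_induct_rule[of size])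
    case (less S)
    have "\<beta> (trunk S) = \<beta> (trunk T)" and gr: "map (map ?\<phi>) (grafts S) = map (map ?\<phi>) (grafts T)"
      using decompose less.prems by metis+
    then have "trunk S = trunk T"
      using inj troupe_trunk[OF troupe] less.prems forkless_trunk by (auto dest: inj_onD)
    moreover have "grafts S = grafts T"
    proof (rule list.inj_map_strong[OF _ gr])
      fix d e assume d: "d \<in> set (grafts S)" and e: "e \<in> set (grafts T)"
        and eq: "map ?\<phi> d = map ?\<phi> e"
      show "d = e"
        using less.IH[OF size_grafts_less[OF d]] troupe_grafts[OF troupe] less.prems d e
        by (intro list.inj_map_strong[OF _ eq]) blast
    qed
    ultimately show "S = T"
      using graft_trunk_grafts troupe_black_forks[OF troupe] less.prems by metis
  qed
qed

lemma transplant_in_troupe: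
  assumes troupe: "troupe C black TT" and troupe': "troupe C black TT'"
    and \<beta>: "\<And>b. b \<in> TT \<Longrightarrow> forkless b \<Longrightarrow> \<beta> b \<in> TT' \<and> forkless (\<beta> b) \<and> size (\<beta> b) = size b"
  shows "T \<in> TT \<Longrightarrow> transplant black \<beta> T \<in> TT'"
proof (induction T rule: measure_induct_rule[of size])
  case (less T)
  let ?\<phi> = "transplant black \<beta>"
  have b: "\<beta> (trunk T) \<in> TT' \<and> forkless (\<beta> (trunk T)) \<and> size (\<beta> (trunk T)) = size (trunk T)"
    using \<beta> troupe_trunk[OF troupe less.prems] forkless_trunk by blast
  have "?\<phi> t \<in> TT' - {Leaf}" if "d \<in> set (grafts T)" "t \<in> set d" for d t
  proof -
    have t: "t \<in> TT" using troupe_grafts[OF troupe less.prems that] .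
    have "size (?\<phi> t) = size t" by (rule size_transplant[OF troupe _ t]) (simp add: \<beta>)
    moreover have "t \<noteq> Leaf" using grafts_nonempty that by blast
    ultimately have "?\<phi> t \<noteq> Leaf" by (metis eq_size_0)
    then show ?thesis using less.IH[OF size_grafts_less[OF that] t] by simp
  qed
  then have "\<forall>d \<in> set (map (map ?\<phi>) (grafts T)). set d \<subseteq> TT' - {Leaf}" by fastforce
  then show ?case
    using troupe_graft[OF troupe'] b by (simp add: transplant.simps[of black \<beta> T] length_grafts)
qed

section \<open>Comparing two troupes\<close>

lemma branches_of_size:
  "troupe C black TT \<Longrightarrow> of_size TT n \<inter> Branch C = {b \<in> TT. forkless b \<and> size b = n}"
  by (auto simp: of_size_def Branch_def forkless_def troupe_def)

lemma card_of_size_le: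
  assumes fin: "finite C" and troupe: "troupe C black TT" and troupe': "troupe C black TT'"
    and card: "\<And>n. card (of_size TT n \<inter> Branch C) = card (of_size TT' n \<inter> Branch C)"
  shows "card (of_size TT n) \<le> card (of_size TT' n)"
proof -
  have CBPT: "TT \<subseteq> CBPT C" "TT' \<subseteq> CBPT C" using troupe troupe' by (auto simp: troupe_def)
  have "\<forall>n. \<exists>f. bij_betw f {b \<in> TT. forkless b \<and> size b = n}
      {b \<in> TT'. forkless b \<and> size b = n}"
    unfolding branches_of_size[OF troupe, symmetric] branches_of_size[OF troupe', symmetric]
    using finite_of_size[OF fin] CBPT by (intro allI finite_same_card_bij card) auto
  from choice[OF this] obtain f where f: "bij_betw (f n) {b \<in> TT. forkless b \<and> size b = n}
      {b \<in> TT'. forkless b \<and> size b = n}" for n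
    by blast
  define \<beta> where "\<beta> b = f (size b) b" for b
  have \<beta>: "\<beta> b \<in> TT' \<and> forkless (\<beta> b) \<and> size (\<beta> b) = size b" if "b \<in> TT" "forkless b" for b
    using bij_betwE[OF f[of "size b"]] that by (simp add: \<beta>_def)
  have "inj_on \<beta> {b \<in> TT. forkless b}"
  proof (rule inj_onI)
    fix b b' assume bb': "b \<in> {b \<in> TT. forkless b}" "b' \<in> {b \<in> TT. forkless b}" "\<beta> b = \<beta> b'"
    then have "size b = size b'" using \<beta> by (metis mem_Collect_eq)
    then show "b = b'"
      using bb' inj_onD[OF bij_betw_imp_inj_on[OF f[of "size b"]], of b b'] by (simp add: \<beta>_def)
  qed
  then have "inj_on (transplant black \<beta>) TT"
    using \<beta> by (intro inj_on_transplant[OF troupe]) auto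
  then have "inj_on (transplant black \<beta>) (of_size TT n)"
    by (rule inj_on_subset) (auto simp: of_size_def)
  moreover have "transplant black \<beta> ` of_size TT n \<subseteq> of_size TT' n"
    using transplant_in_troupe[OF troupe troupe' \<beta>] size_transplant[OF troupe] \<beta>
    by (auto simp: of_size_def)
  ultimately show ?thesis
    using finite_of_size[OF fin CBPT(2)] by (rule card_inj_on_le)
qed

theorem theorem10p1:
  fixes C :: "'c set" and black white :: 'c
    and TT TT' :: "'c tree set"
  assumes "finite C" and "black \<in> C" and "white \<in> C" and "black \<noteq> white"
    and "troupe C black TT" and "troupe C black TT'"
    and "\<And>n. card (of_size TT n \<inter> Branch C) = card (of_size TT' n \<inter> Branch C)"
  shows "\<forall>n. card (of_size TT n) = card (of_size TT' n)"
proof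
  fix n
  show "card (of_size TT n) = card (of_size TT' n)"
  proof (rule antisym)
    show "card (of_size TT n) \<le> card (of_size TT' n)"
      using assms(1,5,6,7) by (rule card_of_size_le)
    show "card (of_size TT' n) \<le> card (of_size TT n)"
      using assms(1,6,5) assms(7)[symmetric] by (rule card_of_size_le)
  qed
qed

end
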